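(* Let $a_1,a_2,b_1,b_2\in\mathbb{R}$ and let $f\in\Gamma_0(\mathbb{R})$ be the function $f(x)=\frac12 a_1x^2+b_1x$ for $x\le 0$ and $f(x)=\frac12 a_2x^2+b_2x$ for $x\ge 0$; assume $f$ is sparsity promoting. Let $\alpha,\beta>0$ and $f_\alpha := f-\mathrm{env}_{\alpha f}$. Then the following statements hold. (i) $\mathrm{prox}_{\beta f_\alpha}$ is set-valued at at most one point at each side of the origin. Moreover, $\mathrm{prox}_{\beta f_\alpha}$ is piecewise linear on any interval not containing these possible set-valued points. (ii) For any $x\in\mathbb{R}$ and any $p \in \mathrm{prox}_{\beta f_\alpha}(x)$, $|p| \leq |x|$. Furthermore, $\mathrm{sgn}(p) = \mathrm{sgn}(x)$ if both $p$ and $x$ are nonzero.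
   Context: For a proper lower semicontinuous $g:\mathbb{R}\to(-\infty,+\infty]$ and $\alpha>0$: $\mathrm{env}_{\alpha g}(x)=\inf_{u\in\mathbb{R}}\{g(u)+\frac{1}{2\alpha}(u-x)^2\}$, and $\mathrm{prox}_{\alpha g}(x)=\mathrm{argmin}_{u\in\mathbb{R}}\{g(u)+\frac{1}{2\alpha}(u-x)^2\}$, which is a set. "Set-valued at $x$" means that $\mathrm{prox}_{\beta f_\alpha}(x)$ has more than one element; "at each side of the origin" refers to $(-\infty,0)$ and $(0,\infty)$. "Piecewise linear" means piecewise affine with finitely many pieces, the operator being viewed as an ordinary function where it is single-valued. $\mathrm{sgn}$ is the signum function. $\Gamma_0(\mathbb{R})$ denotes the proper lower semicontinuous convex functions on $\mathbb{R}$. A function $f$ is sparsity promoting if (i) $f(0)=0$ and $f$ achieves its global minimum at the origin, and (ii) $\partial f(0)$ contains at least one nonzero element, where $\partial$ is the (convex) subdifferential. *)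

theory Defs
  imports "HOL-Analysis.Analysis"
begin

definition proper_fun :: "(real \<Rightarrow> ereal) \<Rightarrow> bool" where
  "proper_fun g \<longleftrightarrow> (\<forall>x. g x \<noteq> -\<infinity>) \<and> (\<exists>x. g x \<noteq> \<infinity>)"

definition lsc_fun :: "(real \<Rightarrow> ereal) \<Rightarrow> bool" where
  "lsc_fun g \<longleftrightarrow> (\<forall>x. g x \<le> Liminf (at x) g)"

definition convex_fun :: "(real \<Rightarrow> ereal) \<Rightarrow> bool" where
  "convex_fun g \<longleftrightarrow> convex {(x, r::real). g x \<le> ereal r}"

definition Gamma0 :: "(real \<Rightarrow> ereal) set" where
  "Gamma0 = {g. proper_fun g \<and> lsc_fun g \<and> convex_fun g}"

definition subdifferential :: "(real \<Rightarrow> ereal) \<Rightarrow> real \<Rightarrow> real set" where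
  "subdifferential g x = {v. \<bar>g x\<bar> \<noteq> \<infinity> \<and> (\<forall>y. g y \<ge> g x + ereal (v * (y - x)))}"

definition sparsity_promoting :: "(real \<Rightarrow> ereal) \<Rightarrow> bool" where
  "sparsity_promoting g \<longleftrightarrow>
     g 0 = 0 \<and> (\<forall>x. g 0 \<le> g x) \<and> (\<exists>v \<in> subdifferential g 0. v \<noteq> 0)"

text \<open>
  The parameter and the function are passed separately: env of \<open>\<alpha>\<close>, \<open>g\<close> is the usual
  \<open>env\<^bsub>\<alpha>g\<^esub>\<close> (the infimum is of \<open>g\<close> plus the quadratic, not scaled by \<open>\<alpha>\<close>), likewise prox.
\<close>

definition env :: "real \<Rightarrow> (real \<Rightarrow> ereal) \<Rightarrow> real \<Rightarrow> ereal" where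
  "env \<alpha> g x = (INF u. g u + ereal (1 / (2 * \<alpha>) * (u - x)\<^sup>2))"

definition prox :: "real \<Rightarrow> (real \<Rightarrow> ereal) \<Rightarrow> real \<Rightarrow> real set" where
  "prox \<alpha> g x =
     {p. is_arg_min (\<lambda>u. g u + ereal (1 / (2 * \<alpha>) * (u - x)\<^sup>2)) (\<lambda>_. True) p}"

text \<open>
  The function \<open>f\<^sub>\<alpha> = f - env\<^bsub>\<alpha>f\<^esub>\<close>.  For real-valued \<open>f\<close> bounded below the envelope is finite,
  so no difference of infinities occurs.
\<close>

definition env_diff :: "real \<Rightarrow> (real \<Rightarrow> ereal) \<Rightarrow> real \<Rightarrow> ereal" where
  "env_diff \<alpha> f x = f x - env \<alpha> f x"

definition set_valued_at :: "(real \<Rightarrow> real set) \<Rightarrow> real \<Rightarrow> bool" where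
  "set_valued_at F x \<longleftrightarrow> (\<exists>p \<in> F x. \<exists>q \<in> F x. p \<noteq> q)"

text \<open>
  The pieces are closed intervals, i.e. polyhedral subsets of the line.  A finite cover by such
  pieces forces \<open>T\<close> to be continuous on \<open>I\<close>, so one-point pieces cannot hide jumps.
\<close>

definition piecewise_affine_on :: "real set \<Rightarrow> (real \<Rightarrow> real) \<Rightarrow> bool" where
  "piecewise_affine_on I T \<longleftrightarrow>
     (\<exists>\<P>. finite \<P> \<and> (\<forall>J \<in> \<P>. is_interval J \<and> closed J) \<and> I \<subseteq> \<Union>\<P> \<and>
        (\<forall>J \<in> \<P>. \<exists>m c. \<forall>x \<in> J \<inter> I. T x = m * x + c))"

text \<open>
  The operator is single-valued (in particular nonempty) on \<open>I\<close>, and the ordinary function it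
  represents there is piecewise affine.
\<close>

definition piecewise_affine_operator_on :: "real set \<Rightarrow> (real \<Rightarrow> real set) \<Rightarrow> bool" where
  "piecewise_affine_operator_on I F \<longleftrightarrow>
     (\<exists>T. (\<forall>x \<in> I. F x = {T x}) \<and> piecewise_affine_on I T)"

end

theory Submission
  imports Defs
begin

text \<open>
  Nonnegativity of \<open>f\<close> forces \<open>a\<^sub>1\<close>, \<open>a\<^sub>2\<close>, \<open>b\<^sub>2\<close> and \<open>- b\<^sub>1\<close> to be
  nonnegative. On the right half-line the proximal point of \<open>f\<close> is a soft threshold, so the
  envelope, and with it \<open>f\<^sub>\<alpha>\<close>, is explicit (\<open>env_diff_eq_branch\<close>): it is
  continuously differentiable on \<open>(0, \<infinity>)\<close> and quadratic on either side of the single breakpoint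
  \<open>\<alpha> * b\<^sub>2\<close>. It vanishes at the origin and is nondecreasing to the right of it
  (\<open>env_diff_branch_mono\<close>). The left half-line is the mirror image.

  For \<open>x \<ge> 0\<close> this confines the minimizers of \<open>f\<^sub>\<alpha> + (\<cdot> - x)\<^sup>2 / (2 * \<beta>)\<close>
  to \<open>[0, x]\<close>: compared with \<open>x\<close>, a point beyond it gains nothing in the first term
  and loses in the second; a negative point is likewise worse than the origin. That is the bound and the sign claim.

  The objective is strictly convex beyond the breakpoint, whatever \<open>\<beta>\<close> is, while its curvature
  before the breakpoint may have either sign. A positive minimizer is a critical point, and the
  criticality equation is affine in \<open>x\<close> on each of the two ranges. Suppose two minimizers
  \<open>p < p'\<close> for some \<open>x > 0\<close> and two minimizers \<open>q < q'\<close> for some \<open>y > x\<close>. Since proximal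
  maps are monotone, \<open>p' \<le> q\<close>, so \<open>q\<close> and \<open>q'\<close> are positive. Beyond the breakpoint
  minimizers are unique, hence \<open>q\<close>, and therefore also \<open>p'\<close>, lies strictly before it. A
  minimizer there that is not unique forces the curvature to vanish, and then the criticality
  equation determines the base point, so \<open>x = y\<close> (\<open>set_valued_below\<close>).

  Where the proximal map is single-valued, its values in each of five intervals (zero, and before
  or beyond the breakpoint on either side) obey one affine law. Monotonicity and the closed graph turn
  this into a finite cover by closed intervals
  (\<open>piecewise_affine_on_if_affine_on_value_ranges\<close>).
\<close>

section \<open>Proximal maps of real-valued functions\<close>

lemma mem_prox_iff:
  "p \<in> prox \<beta> (\<lambda>u. ereal (G u)) x \<longleftrightarrow>
     (\<forall>u. G p + 1 / (2 * \<beta>) * (p - x)\<^sup>2 \<le> G u + 1 / (2 * \<beta>) * (u - x)\<^sup>2)"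
  by (simp add: prox_def is_arg_min_def not_less)

lemma prox_reflect:
  "p \<in> prox \<beta> (\<lambda>u. ereal (G (- u))) x \<longleftrightarrow> - p \<in> prox \<beta> (\<lambda>u. ereal (G u)) (- x)"
proof -
  have sq: "(- u - - v)\<^sup>2 = (u - v)\<^sup>2" for u v :: real
    by (simp add: power2_commute)
  have "(\<forall>u. G (- p) + 1 / (2 * \<beta>) * (p - x)\<^sup>2 \<le> G (- u) + 1 / (2 * \<beta>) * (u - x)\<^sup>2) \<longleftrightarrow>
        (\<forall>u. G (- p) + 1 / (2 * \<beta>) * (- p - - x)\<^sup>2 \<le> G u + 1 / (2 * \<beta>) * (u - - x)\<^sup>2)"
    (is "(\<forall>u. ?A u) \<longleftrightarrow> (\<forall>u. ?B u)")
  proof -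
    have "?A u \<longleftrightarrow> ?B (- u)" for u
      by (simp only: sq)
    then show ?thesis
      by (metis minus_minus)
  qed
  then show ?thesis
    by (simp only: mem_prox_iff)
qed

lemma set_valued_at_prox_reflect:
  "set_valued_at (prox \<beta> (\<lambda>u. ereal (G (- u)))) x \<longleftrightarrow>
   set_valued_at (prox \<beta> (\<lambda>u. ereal (G u))) (- x)"
  (is "set_valued_at ?F x \<longleftrightarrow> set_valued_at ?H (- x)")
proof -
  have mem: "p \<in> ?F x \<longleftrightarrow> - p \<in> ?H (- x)" for p
    by (rule prox_reflect)
  show ?thesis
    unfolding set_valued_at_def
  proof
    assume "\<exists>p\<in>?F x. \<exists>q\<in>?F x. p \<noteq> q"
    then obtain p q where "p \<in> ?F x" "q \<in> ?F x" "p \<noteq> q"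
      by blast
    then have "- p \<in> ?H (- x)" "- q \<in> ?H (- x)" "- p \<noteq> - q"
      by (simp_all add: mem)
    then show "\<exists>p\<in>?H (- x). \<exists>q\<in>?H (- x). p \<noteq> q"
      by blast
  next
    assume "\<exists>p\<in>?H (- x). \<exists>q\<in>?H (- x). p \<noteq> q"
    then obtain p q where "p \<in> ?H (- x)" "q \<in> ?H (- x)" "p \<noteq> q"
      by blast
    then have "- p \<in> ?F x" "- q \<in> ?F x" "- p \<noteq> - q"
      by (simp_all add: mem)
    then show "\<exists>p\<in>?F x. \<exists>q\<in>?F x. p \<noteq> q"
      by blast
  qed
qed

text \<open>
  Adding the two optimality inequalities, each tested at the other minimizer, cancels \<open>G\<close> and
  leaves \<open>(p - q) * (y - x) \<le> 0\<close>.
\<close>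

lemma prox_mono:
  assumes \<beta>: "\<beta> > 0" and xy: "x < y"
    and p: "p \<in> prox \<beta> (\<lambda>u. ereal (G u)) x" and q: "q \<in> prox \<beta> (\<lambda>u. ereal (G u)) y"
  shows "p \<le> q"
proof -
  have "G p + 1 / (2 * \<beta>) * (p - x)\<^sup>2 \<le> G q + 1 / (2 * \<beta>) * (q - x)\<^sup>2"
    and "G q + 1 / (2 * \<beta>) * (q - y)\<^sup>2 \<le> G p + 1 / (2 * \<beta>) * (p - y)\<^sup>2"
    using p q by (auto simp: mem_prox_iff)
  then have "1 / (2 * \<beta>) * ((p - x)\<^sup>2 + (q - y)\<^sup>2 - (q - x)\<^sup>2 - (p - y)\<^sup>2) \<le> 0"
    by (simp add: algebra_simps)
  then have "(p - x)\<^sup>2 + (q - y)\<^sup>2 - (q - x)\<^sup>2 - (p - y)\<^sup>2 \<le> 0"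
    using \<beta> by (simp add: divide_le_0_iff)
  then have "(p - q) * (y - x) \<le> 0"
    by (simp add: power2_eq_square algebra_simps)
  then show ?thesis
    using xy by (simp add: mult_le_0_iff)
qed

lemma prox_closed_graph:
  assumes cont: "continuous_on UNIV G"
    and X: "X \<longlonglongrightarrow> x" and P: "P \<longlonglongrightarrow> p"
    and mem: "\<And>n. P n \<in> prox \<beta> (\<lambda>u. ereal (G u)) (X n)"
  shows "p \<in> prox \<beta> (\<lambda>u. ereal (G u)) x"
  unfolding mem_prox_iff
proof
  fix u
  have "(\<lambda>n. G (P n)) \<longlonglongrightarrow> G p"
    by (rule continuous_on_tendsto_compose[OF cont P]) auto
  then have "(\<lambda>n. G (P n) + 1 / (2 * \<beta>) * (P n - X n)\<^sup>2) \<longlonglongrightarrow> G p + 1 / (2 * \<beta>) * (p - x)\<^sup>2"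
    by (intro tendsto_intros X P)
  moreover have "(\<lambda>n. G u + 1 / (2 * \<beta>) * (u - X n)\<^sup>2) \<longlonglongrightarrow> G u + 1 / (2 * \<beta>) * (u - x)\<^sup>2"
    by (intro tendsto_intros X)
  ultimately show "G p + 1 / (2 * \<beta>) * (p - x)\<^sup>2 \<le> G u + 1 / (2 * \<beta>) * (u - x)\<^sup>2"
    by (rule LIMSEQ_le) (use mem in \<open>auto simp: mem_prox_iff\<close>)
qed

section \<open>Monotone maps with finitely many affine laws\<close>

text \<open>
  Monotonicity makes each set of points whose value lies in an interval \<open>K\<close> an interval.
  An affine law valid on such a set extends to its closure: along a convergent sequence in the set
  the law makes the values converge, and the closed graph identifies their limit.  The closures
  are therefore pieces.
\<close>

lemma piecewise_affine_on_if_affine_on_value_ranges: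
  fixes T :: "real \<Rightarrow> real"
  assumes I: "is_interval I"
    and mono: "\<And>x y. x \<in> I \<Longrightarrow> y \<in> I \<Longrightarrow> x < y \<Longrightarrow> T x \<le> T y"
    and closed_graph: "\<And>X x p. (\<And>n. X n \<in> I) \<Longrightarrow> x \<in> I \<Longrightarrow> X \<longlonglongrightarrow> x \<Longrightarrow>
                   (\<lambda>n. T (X n)) \<longlonglongrightarrow> p \<Longrightarrow> T x = p"
    and fin: "finite \<K>" and int: "\<And>K. K \<in> \<K> \<Longrightarrow> is_interval K"
    and cover: "T ` I \<subseteq> \<Union>\<K>"
    and aff: "\<And>K. K \<in> \<K> \<Longrightarrow> \<exists>m c. \<forall>x\<in>I. T x \<in> K \<longrightarrow> T x = m * x + c"
  shows "piecewise_affine_on I T"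
proof -
  define S where "S K = {x \<in> I. T x \<in> K}" for K
  have intS: "is_interval (S K)" if K: "K \<in> \<K>" for K
    unfolding is_interval_1
  proof (intro ballI allI impI)
    fix x z y assume x: "x \<in> S K" and z: "z \<in> S K" and y: "x \<le> y \<and> y \<le> z"
    have yI: "y \<in> I"
      using I x z y unfolding S_def is_interval_1 by blast
    have "T x \<le> T y" "T y \<le> T z"
      using mono[of x y] mono[of y z] x z y yI unfolding S_def by (force simp: less_le)+
    then have "T y \<in> K"
      using int[OF K] x z unfolding S_def is_interval_1 by blast
    then show "y \<in> S K"
      using yI by (simp add: S_def)
  qed
  have affJ: "\<exists>m c. \<forall>x \<in> closure (S K) \<inter> I. T x = m * x + c" if K: "K \<in> \<K>" for K
  proof -
    obtain m c where mc: "\<And>x. x \<in> I \<Longrightarrow> T x \<in> K \<Longrightarrow> T x = m * x + c"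
      using aff[OF K] by blast
    have "T x = m * x + c" if x: "x \<in> closure (S K)" "x \<in> I" for x
    proof -
      obtain X where X: "\<And>n. X n \<in> S K" "X \<longlonglongrightarrow> x"
        using x(1) unfolding closure_sequential by blast
      have "(\<lambda>n. m * X n + c) \<longlonglongrightarrow> m * x + c"
        by (intro tendsto_intros X)
      moreover have "(\<lambda>n. m * X n + c) = (\<lambda>n. T (X n))"
        using X(1) mc unfolding S_def by auto
      ultimately have "(\<lambda>n. T (X n)) \<longlonglongrightarrow> m * x + c"
        by simp
      with closed_graph[of X x] X x(2) show ?thesis
        unfolding S_def by blast
    qed
    then show ?thesis
      by blast
  qed
  show ?thesis
    unfolding piecewise_affine_on_def
  proof (intro exI[of _ "(\<lambda>K. closure (S K)) ` \<K>"] conjI ballI)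
    show "finite ((\<lambda>K. closure (S K)) ` \<K>)"
      using fin by simp
    show "I \<subseteq> \<Union>((\<lambda>K. closure (S K)) ` \<K>)"
    proof
      fix x assume x: "x \<in> I"
      then obtain K where "K \<in> \<K>" "x \<in> S K"
        using cover unfolding S_def by blast
      then show "x \<in> \<Union>((\<lambda>K. closure (S K)) ` \<K>)"
        using closure_subset[of "S K"] by blast
    qed
  next
    fix J assume "J \<in> (\<lambda>K. closure (S K)) ` \<K>"
    then obtain K where K: "K \<in> \<K>" "J = closure (S K)"
      by blast
    show "is_interval J"
      using intS[OF K(1)] K(2) by (simp add: is_interval_convex_1 convex_closure)
    show "closed J"
      by (simp add: K(2))
    show "\<exists>m c. \<forall>x \<in> J \<inter> I. T x = m * x + c"
      using affJ[OF K(1)] K(2) by simp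
  qed
qed

section \<open>The difference of a quadratic branch and its envelope\<close>

text \<open>
  The restriction of \<open>f - env\<^bsub>\<alpha>f\<^esub>\<close> to the nonnegative half-line when \<open>f\<close> is
  \<open>a / 2 * u\<^sup>2 + b * u\<close> there: the envelope equals \<open>u\<^sup>2 / (2 * \<alpha>)\<close> up to the
  threshold \<open>\<alpha> * b\<close>, below which the proximal point of \<open>f\<close> is the origin, and the last term
  is the gain from moving away from the origin beyond it.
\<close>

definition env_diff_branch :: "real \<Rightarrow> real \<Rightarrow> real \<Rightarrow> real \<Rightarrow> real" where
  "env_diff_branch \<alpha> a b u =
     a / 2 * u\<^sup>2 + b * u - u\<^sup>2 / (2 * \<alpha>) + (max 0 (u - \<alpha> * b))\<^sup>2 / (2 * \<alpha> * (1 + \<alpha> * a))"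

lemma env_diff_branch_0: "\<alpha> > 0 \<Longrightarrow> b \<ge> 0 \<Longrightarrow> env_diff_branch \<alpha> a b 0 = 0"
  by (simp add: env_diff_branch_def max_absorb1)

lemma continuous_on_env_diff_branch [continuous_intros]:
  fixes h :: "real \<Rightarrow> real"
  assumes "continuous_on S h"
  shows "continuous_on S (\<lambda>u. env_diff_branch \<alpha> a b (h u))"
  unfolding env_diff_branch_def divide_inverse
  by (intro continuous_on_add continuous_on_diff continuous_on_mult continuous_on_power
      continuous_on_max continuous_on_const assms)

text \<open>
  The slope falls (or rises) affinely from \<open>b\<close> at the origin to \<open>\<alpha> * a * b\<close> at the
  threshold and is nondecreasing afterwards, so it is never negative.
\<close>

lemma env_diff_branch_mono:
  assumes \<alpha>: "\<alpha> > 0" and a: "a \<ge> 0" and b: "b \<ge> 0" and uv: "0 \<le> u" "u \<le> v"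
  shows "env_diff_branch \<alpha> a b u \<le> env_diff_branch \<alpha> a b v"
proof -
  have low: "env_diff_branch \<alpha> a b u \<le> env_diff_branch \<alpha> a b v"
    if "0 \<le> u" "u \<le> v" "v \<le> \<alpha> * b" for u v
  proof -
    have "env_diff_branch \<alpha> a b v - env_diff_branch \<alpha> a b u =
          (v - u) * (a * (u + v) / 2 + (b - (u + v) / (2 * \<alpha>)))"
      using that \<alpha> by (simp add: env_diff_branch_def max_def power2_eq_square field_simps)
    moreover have "(u + v) / (2 * \<alpha>) \<le> b"
      using that \<alpha> by (simp add: field_simps)
    then have "0 \<le> (v - u) * (a * (u + v) / 2 + (b - (u + v) / (2 * \<alpha>)))"
      using that a by (intro mult_nonneg_nonneg add_nonneg_nonneg) auto
    ultimately show ?thesis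
      by linarith
  qed
  have high: "env_diff_branch \<alpha> a b u \<le> env_diff_branch \<alpha> a b v"
    if "\<alpha> * b \<le> u" "u \<le> v" for u v
  proof -
    define D where "D = 1 + \<alpha> * a"
    have D: "D > 0"
      using \<alpha> a by (simp add: D_def add_pos_nonneg)
    \<comment> \<open>The expansion at the threshold: slope \<open>\<alpha> * a * b\<close> and nonnegative curvature.\<close>
    have eq: "env_diff_branch \<alpha> a b w =
        (a / 2 * (\<alpha> * b)\<^sup>2 + b * (\<alpha> * b) - (\<alpha> * b)\<^sup>2 / (2 * \<alpha>)) +
        (\<alpha> * a * b * (w - \<alpha> * b) + \<alpha> * a\<^sup>2 / (2 * D) * (w - \<alpha> * b)\<^sup>2)" if "\<alpha> * b \<le> w" for w
    proof -
      have "\<alpha> * a\<^sup>2 / (2 * D) = a / 2 - 1 / (2 * \<alpha>) + 1 / (2 * \<alpha> * D)"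
        using \<alpha> D by (simp add: field_simps) (simp add: D_def power2_eq_square algebra_simps)
      then show ?thesis
        using that \<alpha> D unfolding env_diff_branch_def D_def[symmetric]
        by (simp add: max_def power2_eq_square) (simp add: field_simps)
    qed
    have "\<alpha> * b \<le> v"
      using that by linarith
    note e = eq[OF that(1)] eq[OF this]
    have "\<alpha> * a * b * (u - \<alpha> * b) \<le> \<alpha> * a * b * (v - \<alpha> * b)"
      using \<alpha> a b that by (intro mult_left_mono) auto
    moreover have "\<alpha> * a\<^sup>2 / (2 * D) * (u - \<alpha> * b)\<^sup>2 \<le> \<alpha> * a\<^sup>2 / (2 * D) * (v - \<alpha> * b)\<^sup>2"
      using \<alpha> D that by (intro mult_left_mono power_mono) auto
    ultimately show ?thesis
      unfolding e by linarith
  qed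
  show ?thesis
  proof (cases "v \<le> \<alpha> * b \<or> \<alpha> * b \<le> u")
    case True
    then show ?thesis
      using low high uv by blast
  next
    case False
    then show ?thesis
      using low[of u "\<alpha> * b"] high[of "\<alpha> * b" v] uv by auto
  qed
qed

lemma env_diff_branch_nonneg:
  assumes "\<alpha> > 0" "a \<ge> 0" "b \<ge> 0" "0 \<le> u"
  shows "0 \<le> env_diff_branch \<alpha> a b u"
  using env_diff_branch_mono[of \<alpha> a b 0 u] env_diff_branch_0[of \<alpha> b a] assms by simp

lemma env_diff_eq_branch:
  assumes \<alpha>: "\<alpha> > 0" and a: "a \<ge> 0" and b: "b \<ge> 0"
    and right: "\<And>u. 0 \<le> u \<Longrightarrow> f u = ereal (a / 2 * u\<^sup>2 + b * u)"
    and nonneg: "\<And>u. 0 \<le> f u"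
    and x: "0 \<le> x"
  shows "env_diff \<alpha> f x = ereal (env_diff_branch \<alpha> a b x)"
proof -
  define D where "D = 1 + \<alpha> * a"
  have D: "D > 0"
    using \<alpha> a by (simp add: D_def add_pos_nonneg)
  define t where "t = max 0 (x - \<alpha> * b)"
  have t0: "0 \<le> t" and t1: "x - \<alpha> * b \<le> t" and t2: "t * t = (x - \<alpha> * b) * t"
    by (auto simp: t_def max_def)
  define V where "V = x\<^sup>2 / (2 * \<alpha>) - t\<^sup>2 / (2 * \<alpha> * D)"
  \<comment> \<open>Completing the square around the soft-thresholded point \<open>t / D\<close>. The last term is
    nonnegative for \<open>u \<ge> 0\<close> and vanishes at that point, so \<open>V\<close> is the minimum over
    the right half-line.\<close>
  have sq: "a / 2 * u\<^sup>2 + b * u + 1 / (2 * \<alpha>) * (u - x)\<^sup>2 =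
            V + D / (2 * \<alpha>) * (u - t / D)\<^sup>2 + (t - (x - \<alpha> * b)) * u / \<alpha>" for u
  proof -
    have aD: "a = (D - 1) / \<alpha>"
      using \<alpha> by (simp add: D_def)
    show ?thesis
      unfolding V_def aD using \<alpha> D by (simp add: power2_eq_square field_simps)
  qed
  have "env \<alpha> f x = ereal V"
    unfolding env_def
  proof (rule antisym)
    have "(t - (x - \<alpha> * b)) * t = 0"
      using t2 by (simp add: left_diff_distrib)
    then have "(t - (x - \<alpha> * b)) * (t / D) / \<alpha> = 0"
      by simp
    then have "f (t / D) + ereal (1 / (2 * \<alpha>) * (t / D - x)\<^sup>2) = ereal V"
      using sq[of "t / D"] right[of "t / D"] t0 D by simp
    then show "(INF u. f u + ereal (1 / (2 * \<alpha>) * (u - x)\<^sup>2)) \<le> ereal V"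
      by (intro INF_lower2[of "t / D"]) auto
  next
    show "ereal V \<le> (INF u. f u + ereal (1 / (2 * \<alpha>) * (u - x)\<^sup>2))"
    proof (rule INF_greatest)
      fix u
      show "ereal V \<le> f u + ereal (1 / (2 * \<alpha>) * (u - x)\<^sup>2)"
      proof (cases "0 \<le> u")
        case True
        have "0 \<le> D / (2 * \<alpha>) * (u - t / D)\<^sup>2"
          using D \<alpha> by simp
        moreover have "0 \<le> (t - (x - \<alpha> * b)) * u / \<alpha>"
          using t1 True \<alpha> by simp
        ultimately have "V \<le> a / 2 * u\<^sup>2 + b * u + 1 / (2 * \<alpha>) * (u - x)\<^sup>2"
          unfolding sq by linarith
        then show ?thesis
          using right[OF True] by simp
      next
        case False
        \<comment> \<open>A negative point is no better than the origin, whose value is already at least \<open>V\<close>.\<close>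
        have "V \<le> 1 / (2 * \<alpha>) * x\<^sup>2"
          using D \<alpha> by (simp add: V_def)
        also have "\<dots> \<le> 1 / (2 * \<alpha>) * (u - x)\<^sup>2"
        proof (rule mult_left_mono)
          show "x\<^sup>2 \<le> (u - x)\<^sup>2"
            using False x by (intro abs_le_square_iff[THEN iffD1]) auto
        qed (use \<alpha> in simp)
        finally have "ereal V \<le> 0 + ereal (1 / (2 * \<alpha>) * (u - x)\<^sup>2)"
          by simp
        also have "\<dots> \<le> f u + ereal (1 / (2 * \<alpha>) * (u - x)\<^sup>2)"
          by (rule add_right_mono[OF nonneg])
        finally show ?thesis .
      qed
    qed
  qed
  then show ?thesis
    using right[OF x]
    by (simp add: env_diff_def env_diff_branch_def V_def t_def D_def)
qed

lemma env_diff_reflect: "env_diff \<alpha> (\<lambda>u. f (- u)) x = env_diff \<alpha> f (- x)"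
proof -
  have sq: "(- u - - x)\<^sup>2 = (u - x)\<^sup>2" for u
    by (simp add: power2_commute)
  have "env \<alpha> f (- x) = (INF u\<in>range uminus. f u + ereal (1 / (2 * \<alpha>) * (u - - x)\<^sup>2))"
    by (simp add: env_def surj_uminus)
  also have "\<dots> = env \<alpha> (\<lambda>u. f (- u)) x"
    by (simp only: env_def image_image sq)
  finally show ?thesis
    by (simp add: env_diff_def)
qed

text \<open>
  The slope \<open>a / 2 * x + b\<close> of the secant from the origin is nonnegative for every positive
  \<open>x\<close>: large \<open>x\<close> decides the sign of \<open>a\<close>, small \<open>x\<close> that of \<open>b\<close>.
\<close>

lemma coefficients_nonneg:
  fixes a b :: real
  assumes "\<And>x. x > 0 \<Longrightarrow> 0 \<le> a / 2 * x\<^sup>2 + b * x"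
  shows "0 \<le> a" and "0 \<le> b"
proof -
  have slope: "0 \<le> a / 2 * x + b" if "x > 0" for x
  proof -
    have "0 \<le> (a / 2 * x + b) * x"
      using assms[OF that] by (simp add: power2_eq_square algebra_simps)
    then show ?thesis
      using that by (simp add: zero_le_mult_iff)
  qed
  show "0 \<le> a"
  proof (rule ccontr)
    assume "\<not> 0 \<le> a"
    define X where "X = 2 * (\<bar>b\<bar> + 1) / - a"
    have "0 < X"
      unfolding X_def using \<open>\<not> 0 \<le> a\<close> by (intro divide_pos_pos) auto
    moreover have "a / 2 * X = - (\<bar>b\<bar> + 1)"
      using \<open>\<not> 0 \<le> a\<close> by (simp add: X_def field_simps)
    ultimately show False
      using slope[of X] by linarith
  qed
  have "((\<lambda>x. a / 2 * x + b) \<longlongrightarrow> a / 2 * 0 + b) (at_right 0)"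
    by (intro tendsto_intros)
  then have "((\<lambda>x. a / 2 * x + b) \<longlongrightarrow> b) (at_right 0)"
    by simp
  moreover have "eventually (\<lambda>x. 0 \<le> a / 2 * x + b) (at_right 0)"
  proof (rule eventually_at_rightI[of 0 1])
    show "0 \<le> a / 2 * x + b" if "x \<in> {0<..<1}" for x
      using slope[of x] that by simp
  qed simp
  ultimately show "0 \<le> b"
    by (rule tendsto_lowerbound) simp
qed

section \<open>Minimizers on one side of the origin\<close>

lemma quadratic_interior_min:
  fixes A B l r p :: real
  assumes p: "l < p" "p < r"
    and min: "\<And>u. l \<le> u \<Longrightarrow> u \<le> r \<Longrightarrow> A * p\<^sup>2 + B * p \<le> A * u\<^sup>2 + B * u"
  shows "2 * A * p + B = 0" and "0 \<le> A"
proof -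
  have der: "((\<lambda>u. A * u\<^sup>2 + B * u) has_real_derivative 2 * A * p + B) (at p)"
    by (auto intro!: derivative_eq_intros)
  show crit: "2 * A * p + B = 0"
  proof (rule DERIV_local_min[OF der, of "min (p - l) (r - p)"])
    show "0 < min (p - l) (r - p)"
      using p by simp
    show "\<forall>u. \<bar>p - u\<bar> < min (p - l) (r - p) \<longrightarrow> A * p\<^sup>2 + B * p \<le> A * u\<^sup>2 + B * u"
      by (auto simp: abs_if split: if_splits intro!: min)
  qed
  have "A * r\<^sup>2 + B * r - (A * p\<^sup>2 + B * p) = A * (r - p)\<^sup>2 + (2 * A * p + B) * (r - p)"
    by (simp add: power2_eq_square algebra_simps)
  then have "0 \<le> A * (r - p)\<^sup>2"
    using min[of r] p crit by simp
  moreover have "0 < (r - p)\<^sup>2"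
    using p by simp
  ultimately show "0 \<le> A"
    by (simp add: zero_le_mult_iff)
qed

text \<open>
  The exact form of \<open>G\<close> is assumed on one half-line only, so that the locale applies to a
  two-branch function and to its mirror image alike.
\<close>

locale right_branch =
  fixes \<alpha> \<beta> a b :: real and G :: "real \<Rightarrow> real"
  assumes \<alpha>: "\<alpha> > 0" and \<beta>: "\<beta> > 0" and a: "a \<ge> 0" and b: "b \<ge> 0"
    and right: "\<And>u. 0 \<le> u \<Longrightarrow> G u = env_diff_branch \<alpha> a b u"
    and nonneg: "\<And>u. 0 \<le> G u"
begin

abbreviation P :: "real \<Rightarrow> real set" where
  "P \<equiv> prox \<beta> (\<lambda>u. ereal (G u))"

definition obj :: "real \<Rightarrow> real \<Rightarrow> real" where
  "obj x u = G u + 1 / (2 * \<beta>) * (u - x)\<^sup>2"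

text \<open>
  The second derivatives of the objective before and beyond the breakpoint \<open>\<alpha> * b\<close>.
\<close>

definition inner_curv :: real where
  "inner_curv = a - 1 / \<alpha> + 1 / \<beta>"

definition outer_curv :: real where
  "outer_curv = inner_curv + 1 / (\<alpha> * (1 + \<alpha> * a))"

lemma mem_P: "p \<in> P x \<longleftrightarrow> (\<forall>u. obj x p \<le> obj x u)"
  by (simp add: mem_prox_iff obj_def)

lemma G_0: "G 0 = 0"
  using right[of 0] env_diff_branch_0[OF \<alpha> b] by simp

lemma obj_neg:
  assumes "0 \<le> x" "u < 0"
  shows "obj x 0 < obj x u"
proof -
  have "x\<^sup>2 < (u - x)\<^sup>2"
    using assms by (subst power2_commute) (auto intro!: power_strict_mono)
  then have "1 / (2 * \<beta>) * x\<^sup>2 < 1 / (2 * \<beta>) * (u - x)\<^sup>2"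
    using \<beta> by (intro mult_strict_left_mono) auto
  then show ?thesis
    using nonneg[of u] by (simp add: obj_def G_0)
qed

lemma obj_beyond:
  assumes "0 \<le> x" "x < u"
  shows "obj x x < obj x u"
proof -
  have "G x \<le> G u"
    using assms right env_diff_branch_mono[OF \<alpha> a b] by simp
  moreover have "0 < 1 / (2 * \<beta>) * (u - x)\<^sup>2"
    using assms \<beta> by simp
  ultimately show ?thesis
    by (simp add: obj_def)
qed

lemma prox_between:
  assumes "0 \<le> x" "p \<in> P x"
  shows "0 \<le> p" and "p \<le> x"
proof -
  have min: "obj x p \<le> obj x u" for u
    using assms(2) by (simp add: mem_P)
  show "0 \<le> p"
    using obj_neg[OF assms(1), of p] min[of 0] by linarith
  show "p \<le> x"
    using obj_beyond[OF assms(1), of p] min[of x] by linarith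
qed

lemma prox_nonempty:
  assumes x: "0 \<le> x"
  shows "P x \<noteq> {}"
proof -
  have "continuous_on {0..x} (\<lambda>u. env_diff_branch \<alpha> a b u + 1 / (2 * \<beta>) * (u - x)\<^sup>2)"
    by (intro continuous_intros)
  then have "continuous_on {0..x} (obj x)"
    by (rule continuous_on_eq) (simp add: obj_def right)
  moreover have "{0..x} \<noteq> {}"
    using x by simp
  ultimately obtain p where p: "p \<in> {0..x}" "\<And>u. u \<in> {0..x} \<Longrightarrow> obj x p \<le> obj x u"
    using continuous_attains_inf[OF compact_Icc, of 0 x "obj x"] by blast
  have "obj x p \<le> obj x u" for u
  proof -
    consider "u < 0" | "x < u" | "u \<in> {0..x}"
      by fastforce
    then show ?thesis
    proof cases
      case 1
      then show ?thesis
        using p(2)[of 0] obj_neg[OF x] x by fastforce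
    next
      case 2
      then show ?thesis
        using p(2)[of x] obj_beyond[OF x] x by fastforce
    next
      case 3
      then show ?thesis
        using p(2) by blast
    qed
  qed
  then have "p \<in> P x"
    by (simp add: mem_P)
  then show ?thesis
    by blast
qed

lemma obj_inner:
  assumes "0 \<le> u" "u \<le> \<alpha> * b"
  shows "obj x u = (inner_curv / 2 * u\<^sup>2 + (b - x / \<beta>) * u) + x\<^sup>2 / (2 * \<beta>)"
proof -
  have "G u = (a - 1 / \<alpha>) / 2 * u\<^sup>2 + b * u"
    using assms by (simp add: right env_diff_branch_def max_absorb1 algebra_simps diff_divide_distrib)
  moreover have "1 / (2 * \<beta>) * (u - x)\<^sup>2 = 1 / \<beta> / 2 * u\<^sup>2 - x / \<beta> * u + x\<^sup>2 / (2 * \<beta>)"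
    using \<beta> by (simp add: power2_diff field_simps)
  moreover have "inner_curv / 2 * u\<^sup>2 = (a - 1 / \<alpha>) / 2 * u\<^sup>2 + 1 / \<beta> / 2 * u\<^sup>2"
    by (simp only: inner_curv_def add_divide_distrib distrib_right)
  ultimately show ?thesis
    unfolding obj_def left_diff_distrib by linarith
qed

text \<open>
  The range \<open>(0, \<alpha> * b)\<close> contains a minimizer only if the quadratic before the breakpoint is
  convex and stationary there. The third fact, the expansion at that point, is what compares the
  minimizer with other candidates: a second one before the breakpoint exists only when the quadratic is
  constant.
\<close>

lemma prox_inner:
  assumes p: "p \<in> P x" "0 < p" "p < \<alpha> * b"
  shows "inner_curv * p = x / \<beta> - b" and "0 \<le> inner_curv"
    and "\<And>u. 0 \<le> u \<Longrightarrow> u \<le> \<alpha> * b \<Longrightarrow> obj x u = obj x p + inner_curv / 2 * (u - p)\<^sup>2"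
proof -
  have "inner_curv / 2 * p\<^sup>2 + (b - x / \<beta>) * p \<le> inner_curv / 2 * u\<^sup>2 + (b - x / \<beta>) * u"
    if "0 \<le> u" "u \<le> \<alpha> * b" for u
    using p obj_inner[OF that, of x] obj_inner[of p x] unfolding mem_P
    by (smt (verit))
  note crit = quadratic_interior_min[OF p(2,3) this]
  show e: "inner_curv * p = x / \<beta> - b"
    using crit(1) by simp
  show "0 \<le> inner_curv"
    using crit(2) by simp
  fix u assume u: "0 \<le> u" "u \<le> \<alpha> * b"
  have b': "b - x / \<beta> = - (inner_curv * p)"
    using e by simp
  show "obj x u = obj x p + inner_curv / 2 * (u - p)\<^sup>2"
    using obj_inner[OF u, of x] obj_inner[of p x] p(2,3) unfolding b'
    by (simp add: power2_eq_square field_simps)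
qed

text \<open>
  The envelope takes back only part of the curvature of \<open>f\<close> beyond the breakpoint: what remains is
  \<open>\<alpha> * a\<^sup>2 / (1 + \<alpha> * a) \<ge> 0\<close>, to which the quadratic term adds \<open>1 / \<beta>\<close>.
\<close>

lemma outer_curv_pos: "0 < outer_curv"
proof -
  have D: "1 + \<alpha> * a > 0"
    using \<alpha> a by (simp add: add_pos_nonneg)
  have "outer_curv = \<alpha> * a\<^sup>2 / (1 + \<alpha> * a) + 1 / \<beta>"
  proof -
    have "a - 1 / \<alpha> + 1 / (\<alpha> * (1 + \<alpha> * a)) = \<alpha> * a\<^sup>2 / (1 + \<alpha> * a)"
      using \<alpha> D by (simp add: divide_simps) (simp add: power2_eq_square algebra_simps)
    then show ?thesis
      by (simp add: outer_curv_def inner_curv_def)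
  qed
  then show ?thesis
    using D \<alpha> \<beta> by (simp add: add_nonneg_pos)
qed

text \<open>
  A minimizer may sit exactly at the breakpoint, where the objective is not a single quadratic nearby.
  But the quadratic that the objective equals beyond the breakpoint majorizes it on the whole
  half-line, so a minimizer of the objective that lies at or beyond the breakpoint also minimizes this
  majorant, and does so in the interior of the half-line.
\<close>

lemma prox_outer:
  assumes p: "p \<in> P x" "0 < p" "\<alpha> * b \<le> p"
  shows "p = 1 / (\<beta> * outer_curv) * x + (b / (1 + \<alpha> * a) - b) / outer_curv"
proof -
  define D where "D = 1 + \<alpha> * a"
  have D: "D > 0"
    using \<alpha> a by (simp add: D_def add_pos_nonneg)
  define B where "B = b - x / \<beta> - b / D"
  define Q where "Q u = outer_curv / 2 * u\<^sup>2 + B * u" for u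
  define c where "c = x\<^sup>2 / (2 * \<beta>) + \<alpha> * b\<^sup>2 / (2 * D)"
  have obj: "obj x u = Q u + c + ((max 0 (u - \<alpha> * b))\<^sup>2 - (u - \<alpha> * b)\<^sup>2) / (2 * \<alpha> * D)"
    if "0 \<le> u" for u
    unfolding obj_def right[OF that] env_diff_branch_def Q_def outer_curv_def inner_curv_def c_def
      B_def D_def[symmetric]
    using \<alpha> \<beta> D by (simp add: power2_eq_square field_simps)
  have le: "obj x u \<le> Q u + c" if "0 \<le> u" for u
  proof -
    have "(max 0 (u - \<alpha> * b))\<^sup>2 - (u - \<alpha> * b)\<^sup>2 \<le> 0"
      by (simp add: max_def)
    then show ?thesis
      using obj[OF that] \<alpha> D by (simp add: divide_nonpos_pos)
  qed
  have eq: "obj x p = Q p + c"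
    using obj[of p] p by simp
  have "Q p \<le> Q u" if "0 \<le> u" for u
    using p(1) le[OF that] eq unfolding mem_P by (smt (verit))
  then have "2 * (outer_curv / 2) * p + B = 0"
    using p(2) unfolding Q_def by (intro quadratic_interior_min(1)[of 0 p "p + 1"]) auto
  then have "outer_curv * p = x / \<beta> - b + b / D"
    by (simp add: B_def)
  then have "p = (x / \<beta> - b + b / D) / outer_curv"
    using outer_curv_pos by (simp add: nonzero_eq_divide_eq mult.commute)
  then show ?thesis
    by (simp add: D_def add_divide_distrib diff_divide_distrib)
qed

lemma prox_inner_single_valued:
  assumes p: "p \<in> P x" "0 < p" "p < \<alpha> * b" and single: "\<not> set_valued_at P x"
  shows "p = 1 / (\<beta> * inner_curv) * x + - b / inner_curv"
proof -
  \<comment> \<open>Without curvature the objective would be constant before the breakpoint, and the origin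
    would be a second minimizer.\<close>
  have "inner_curv \<noteq> 0"
  proof
    assume "inner_curv = 0"
    then have "obj x 0 = obj x p"
      using prox_inner(3)[OF p, of 0] p by simp
    then have "0 \<in> P x"
      using p(1) by (simp add: mem_P)
    then show False
      using single p(1,2) by (force simp: set_valued_at_def)
  qed
  then have "p = (x / \<beta> - b) / inner_curv"
    using prox_inner(1)[OF p] by (simp add: nonzero_eq_divide_eq mult.commute)
  then show ?thesis
    by (simp add: diff_divide_distrib)
qed

text \<open>
  Monotonicity puts no minimizer at \<open>y\<close> to the left of the larger one at \<open>x\<close>, which is
  positive. The two
  at \<open>y\<close> cannot both be beyond the breakpoint, where the criticality equation determines the minimizer; and a
  minimizer before the breakpoint is not unique only for zero curvature, when that equation determines
  the base point instead.
\<close>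

lemma set_valued_below:
  assumes xy: "0 < x" "x < y" and sx: "set_valued_at P x" and sy: "set_valued_at P y"
  shows False
proof -
  obtain p p' where p: "p \<in> P x" "p' \<in> P x" "p < p'"
    using sx unfolding set_valued_at_def by (metis linorder_neqE)
  obtain q q' where q: "q \<in> P y" "q' \<in> P y" "q < q'"
    using sy unfolding set_valued_at_def by (metis linorder_neqE)
  have p0: "0 \<le> p"
    using prox_between(1)[of x p] xy p by simp
  have p'q: "p' \<le> q"
    using prox_mono[OF \<beta> xy(2) p(2) q(1)] .
  have "q < \<alpha> * b"
  proof (rule ccontr)
    assume "\<not> q < \<alpha> * b"
    then have "q = q'"
      using prox_outer[OF q(1)] prox_outer[OF q(2)] p p0 p'q q(3) by auto
    then show False
      using q(3) by simp
  qed
  then have p'_in: "0 < p'" "p' < \<alpha> * b" and q_in: "0 < q" "q < \<alpha> * b"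
    using p p0 p'q by linarith+
  have "obj x p = obj x p' + inner_curv / 2 * (p - p')\<^sup>2"
    using prox_inner(3)[OF p(2) p'_in, of p] p0 p(3) p'_in by simp
  moreover have "obj x p = obj x p'"
    using p(1,2) unfolding mem_P by (meson order_antisym)
  ultimately have "inner_curv = 0"
    using p(3) by simp
  then have "x / \<beta> = y / \<beta>"
    using prox_inner(1)[OF p(2) p'_in] prox_inner(1)[OF q(1) q_in] by simp
  then show False
    using xy \<beta> by simp
qed

lemma set_valued_unique:
  assumes "0 < x" "0 < y" "set_valued_at P x" "set_valued_at P y"
  shows "x = y"
  using assms set_valued_below[of x y] set_valued_below[of y x]
  by (cases x y rule: linorder_cases) blast+

end

section \<open>Gluing the two half-lines\<close>

theorem theorem3:
  fixes a1 a2 b1 b2 \<alpha> \<beta> :: real and f :: "real \<Rightarrow> ereal"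
  assumes f_Gamma0: "f \<in> Gamma0"
    and f_left: "\<And>x. x \<le> 0 \<Longrightarrow> f x = ereal (1 / 2 * a1 * x\<^sup>2 + b1 * x)"
    and f_right: "\<And>x. x \<ge> 0 \<Longrightarrow> f x = ereal (1 / 2 * a2 * x\<^sup>2 + b2 * x)"
    and f_sparse: "sparsity_promoting f"
    and \<alpha>_pos: "\<alpha> > 0" and \<beta>_pos: "\<beta> > 0"
  shows "((\<forall>x<0. \<forall>y<0. set_valued_at (prox \<beta> (env_diff \<alpha> f)) x \<longrightarrow>
              set_valued_at (prox \<beta> (env_diff \<alpha> f)) y \<longrightarrow> x = y) \<and>
          (\<forall>x>0. \<forall>y>0. set_valued_at (prox \<beta> (env_diff \<alpha> f)) x \<longrightarrow>
              set_valued_at (prox \<beta> (env_diff \<alpha> f)) y \<longrightarrow> x = y) \<and>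
          (\<forall>I. is_interval I \<longrightarrow> (\<forall>x\<in>I. \<not> set_valued_at (prox \<beta> (env_diff \<alpha> f)) x) \<longrightarrow>
              piecewise_affine_operator_on I (prox \<beta> (env_diff \<alpha> f)))) \<and>
         (\<forall>x. \<forall>p \<in> prox \<beta> (env_diff \<alpha> f) x.
              \<bar>p\<bar> \<le> \<bar>x\<bar> \<and> (p \<noteq> 0 \<longrightarrow> x \<noteq> 0 \<longrightarrow> sgn p = sgn x))"
proof -
  \<comment> \<open>Each branch vanishes at the origin, so this sum is the two-sided gluing; in this form
    it is visibly continuous.\<close>
  define G where "G u = env_diff_branch \<alpha> a2 b2 (max 0 u) + env_diff_branch \<alpha> a1 (- b1) (max 0 (- u))" for u
  have f_nonneg: "0 \<le> f u" for u
    using f_sparse unfolding sparsity_promoting_def by metis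
  have r: "0 \<le> a2 / 2 * x\<^sup>2 + b2 * x" if "0 < x" for x
    using f_nonneg[of x] f_right[of x] that by simp
  have l: "0 \<le> a1 / 2 * x\<^sup>2 + (- b1) * x" if "0 < x" for x
    using f_nonneg[of "- x"] f_left[of "- x"] that by simp
  note nn = coefficients_nonneg[of a2 b2, OF r] coefficients_nonneg[of a1 "- b1", OF l]
  have G_right: "G u = env_diff_branch \<alpha> a2 b2 u" if "0 \<le> u" for u
    using that nn \<alpha>_pos by (simp add: G_def env_diff_branch_0)
  have G_left: "G (- u) = env_diff_branch \<alpha> a1 (- b1) u" if "0 \<le> u" for u
    using that nn \<alpha>_pos by (simp add: G_def env_diff_branch_0)
  have G_nonneg: "0 \<le> G u" for u
    unfolding G_def using nn \<alpha>_pos by (intro add_nonneg_nonneg env_diff_branch_nonneg) auto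
  have G_cont: "continuous_on UNIV G"
    unfolding G_def by (intro continuous_intros)
  have env_right: "env_diff \<alpha> f u = ereal (G u)" if "0 \<le> u" for u
    using env_diff_eq_branch[of \<alpha> a2 b2 f u] G_right[OF that] that nn \<alpha>_pos f_right f_nonneg by simp
  have env_left: "env_diff \<alpha> f (- u) = ereal (G (- u))" if "0 \<le> u" for u
    using env_diff_eq_branch[of \<alpha> a1 "- b1" "\<lambda>u. f (- u)" u] G_left[OF that] that nn \<alpha>_pos
      f_left[of "- v" for v] f_nonneg by (simp add: env_diff_reflect)
  have env_eq: "env_diff \<alpha> f = (\<lambda>u. ereal (G u))"
  proof
    show "env_diff \<alpha> f u = ereal (G u)" for u
      using env_right[of u] env_left[of "- u"] by (cases "0 \<le> u") auto
  qed
  interpret R: right_branch \<alpha> \<beta> a2 b2 G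
    using nn \<alpha>_pos \<beta>_pos G_right G_nonneg by unfold_locales auto
  interpret L: right_branch \<alpha> \<beta> a1 "- b1" "\<lambda>u. G (- u)"
    using nn \<alpha>_pos \<beta>_pos G_left G_nonneg by unfold_locales auto
  let ?P = "prox \<beta> (\<lambda>u. ereal (G u))"
  have reflect: "p \<in> ?P x \<longleftrightarrow> - p \<in> L.P (- x)" for p x
    using prox_reflect[of "- p" \<beta> G "- x"] by simp
  have reflect_set_valued: "set_valued_at ?P x \<longleftrightarrow> set_valued_at L.P (- x)" for x
    using set_valued_at_prox_reflect[of \<beta> G "- x"] by simp
  have between_right: "0 \<le> p \<and> p \<le> x" if "p \<in> ?P x" "0 \<le> x" for p x
    using R.prox_between that by blast
  have between_left: "x \<le> p \<and> p \<le> 0" if "p \<in> ?P x" "x \<le> 0" for p x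
    using L.prox_between[of "- x" "- p"] that by (simp add: reflect)
  have nonempty: "?P x \<noteq> {}" for x
  proof (cases "0 \<le> x")
    case False
    then obtain p where "p \<in> L.P (- x)"
      using L.prox_nonempty[of "- x"] by auto
    then have "- p \<in> ?P x"
      by (simp add: reflect)
    then show ?thesis
      by blast
  qed (use R.prox_nonempty in blast)
  have piecewise: "piecewise_affine_operator_on I ?P"
    if I: "is_interval I" and single: "\<forall>x\<in>I. \<not> set_valued_at ?P x" for I
  proof -
    have "\<forall>x\<in>I. \<exists>p. ?P x = {p}"
      using nonempty single unfolding set_valued_at_def by blast
    then obtain T where T: "\<And>x. x \<in> I \<Longrightarrow> ?P x = {T x}"
      by metis
    \<comment> \<open>Zero and, on either side, the values before and beyond the breakpoint of the
      envelope there.\<close>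
    let ?\<K> = "{{p. p < 0 \<and> p \<le> \<alpha> * b1}, {\<alpha> * b1<..<0}, {0}, {0<..<\<alpha> * b2}, {p. 0 < p \<and> \<alpha> * b2 \<le> p}}"
    have "piecewise_affine_on I T"
    proof (rule piecewise_affine_on_if_affine_on_value_ranges[OF I, where \<K> = ?\<K>])
      show "T x \<le> T y" if "x \<in> I" "y \<in> I" "x < y" for x y
        using prox_mono[OF \<beta>_pos that(3)] T that by blast
    next
      fix X x p
      assume "\<And>n. X n \<in> I" "x \<in> I" "X \<longlonglongrightarrow> x" "(\<lambda>n. T (X n)) \<longlonglongrightarrow> p"
      then have "p \<in> ?P x"
        using T by (intro prox_closed_graph[OF G_cont, of X x "\<lambda>n. T (X n)"]) auto
      then show "T x = p"
        using T \<open>x \<in> I\<close> by auto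
    next
      show "is_interval K" if "K \<in> ?\<K>" for K
        using that by (auto simp: is_interval_1)
      show "T ` I \<subseteq> \<Union>?\<K>"
        by auto
    next
      have mem: "T x \<in> ?P x" "- T x \<in> L.P (- x)" "\<not> set_valued_at ?P x" "\<not> set_valued_at L.P (- x)"
        if "x \<in> I" for x
        using T[OF that] single that reflect reflect_set_valued by auto
      have neg_affine: "\<exists>m c. \<forall>x\<in>I. T x \<in> K \<longrightarrow> T x = m * x + c"
        if "\<And>x. x \<in> I \<Longrightarrow> T x \<in> K \<Longrightarrow> - T x = m * - x + c" for K m c
        using that by (intro exI[of _ m] exI[of _ "- c"]) fastforce
      fix K assume "K \<in> ?\<K>"
      then consider "K = {p. p < 0 \<and> p \<le> \<alpha> * b1}" | "K = {\<alpha> * b1<..<0}" | "K = {0}"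
        | "K = {0<..<\<alpha> * b2}" | "K = {p. 0 < p \<and> \<alpha> * b2 \<le> p}"
        by blast
      then show "\<exists>m c. \<forall>x\<in>I. T x \<in> K \<longrightarrow> T x = m * x + c"
      proof cases
        case 1
        have "- T x = 1 / (\<beta> * L.outer_curv) * - x + (- b1 / (1 + \<alpha> * a1) - - b1) / L.outer_curv"
          if "x \<in> I" "T x \<in> K" for x
          using that 1 by (intro L.prox_outer mem(2)) auto
        then show ?thesis
          by (rule neg_affine)
      next
        case 2
        have "- T x = 1 / (\<beta> * L.inner_curv) * - x + - (- b1) / L.inner_curv"
          if "x \<in> I" "T x \<in> K" for x
          using that 2 by (intro L.prox_inner_single_valued mem) auto
        then show ?thesis
          by (rule neg_affine)
      next
        case 3
        then show ?thesis
          by (intro exI[of _ 0]) simp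
      next
        case 4
        have "T x = 1 / (\<beta> * R.inner_curv) * x + - b2 / R.inner_curv" if "x \<in> I" "T x \<in> K" for x
          using that 4 by (intro R.prox_inner_single_valued mem) auto
        then show ?thesis
          by blast
      next
        case 5
        have "T x = 1 / (\<beta> * R.outer_curv) * x + (b2 / (1 + \<alpha> * a2) - b2) / R.outer_curv"
          if "x \<in> I" "T x \<in> K" for x
          using that 5 by (intro R.prox_outer mem(1)) auto
        then show ?thesis
          by blast
      qed
    qed simp
    then show ?thesis
      using T unfolding piecewise_affine_operator_on_def by blast
  qed
  show ?thesis
    unfolding env_eq
  proof (intro conjI allI impI ballI)
    show "x = y" if "0 < x" "0 < y" "set_valued_at ?P x" "set_valued_at ?P y" for x y
      using R.set_valued_unique that by blast
    show "x = y" if "x < 0" "y < 0" "set_valued_at ?P x" "set_valued_at ?P y" for x y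
      using L.set_valued_unique[of "- x" "- y"] that by (simp add: reflect_set_valued)
    show "piecewise_affine_operator_on I ?P"
      if "is_interval I" "\<forall>x\<in>I. \<not> set_valued_at ?P x" for I
      using piecewise that by blast
  next
    fix x p assume "p \<in> ?P x"
    then have between: "0 \<le> x \<Longrightarrow> 0 \<le> p \<and> p \<le> x" "x \<le> 0 \<Longrightarrow> x \<le> p \<and> p \<le> 0"
      using between_right between_left by blast+
    then show "\<bar>p\<bar> \<le> \<bar>x\<bar>"
      by linarith
    show "sgn p = sgn x" if "p \<noteq> 0" "x \<noteq> 0"
      using between that by (cases "0 < x"; cases "0 < p") (auto simp: sgn_if)
  qed
qed

end
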